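(* Let $(X,T)$ and $(Y,S)$ be minimal systems. Let $\alpha: X\to Eq(X,Y)$ and $\beta: Y\to Eq(X,Y)$ be the factor maps onto the maximal common equicontinuous factor, and let $\gamma: X\times Y\to Eq(X,Y)$, $\gamma(x,y)=\alpha(x)-\beta(y)$. Then the following assertions are equivalent: (1) There is some point $z\in Eq(X,Y)$ such that $\gamma^{-1}(z)$ is a minimal subset of $(X\times Y,T\times S)$. (2) There is a dense $G_\delta$ subset $\Omega\subset Eq(X,Y)$ such that for each $z\in\Omega$, $\gamma^{-1}(z)$ is a minimal subset of $(X\times Y,T\times S)$. (3) $X$ and $Y$ are strongly quasi-disjoint.
   Context: A system $(X,T)$ is a compact metric space $X$ with a homeomorphism $T:X\to X$. It is minimal if every orbit $\{T^nx:n\in\mathbb Z\}$ is dense. A minimal subset is a nonempty closed invariant set in which every orbit is dense. A factor map (homomorphism) $\pi:(X,T)\to(Y,S)$ is a continuous surjection with $\pi\circ T=S\circ\pi$. A system is equicontinuous if for every $\epsilon>0$ there is $\delta>0$ such that $\rho(x,y)<\delta$ implies $\rho(T^nx,T^ny)<\epsilon$ for all $n\in\mathbb Z$. A maximal common equicontinuous factor of minimal systems $(X,T)$ and $(Y,S)$ is an equicontinuous system $(Z,R)$ with factor maps $\alpha:X\to Z$, $\beta:Y\to Z$ such that for every equicontinuous system $(W,Q)$ and factor maps $\phi:X\to W$, $\psi:Y\to W$ there are factor maps $\eta_1,\eta_2:Z\to W$ with $\phi=\eta_1\alpha$ and $\psi=\eta_2\beta$. It exists and is unique up to isomorphism, and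 is denoted $Eq(X,Y)$. Being minimal and equicontinuous, it is identified with a compact abelian metrizable group on which $R$ is translation by a fixed element; subtraction in $\gamma$ refers to this group. Minimal systems $X$ and $Y$ are strongly quasi-disjoint if there is a residual set $\Omega\subset Eq(X,Y)$ such that $\gamma^{-1}(z)$ is a minimal subset of $(X\times Y,T\times S)$ for each $z\in\Omega$. *)

theory Defs
  imports "HOL-Analysis.Analysis" "HOL-Algebra.Group"
begin

text \<open>
  A system is a bundled metric space \<open>X :: 'a metric\<close> together with a map \<open>T\<close> of which only the
  values on \<open>mspace X\<close> matter.
\<close>

definition dynamical_system :: "'a metric \<Rightarrow> ('a \<Rightarrow> 'a) \<Rightarrow> bool" where
  "dynamical_system X T \<longleftrightarrow>
     compact_space (mtopology_of X) \<and> homeomorphic_map (mtopology_of X) (mtopology_of X) T"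

text \<open>Integer powers of a bijection \<open>T\<close> of the set \<open>A\<close>, evaluated at points of \<open>A\<close>.\<close>

definition int_iterate :: "'a set \<Rightarrow> ('a \<Rightarrow> 'a) \<Rightarrow> int \<Rightarrow> 'a \<Rightarrow> 'a" where
  "int_iterate A T n = (if 0 \<le> n then T ^^ nat n else inv_into A T ^^ nat (- n))"

definition full_orbit :: "'a set \<Rightarrow> ('a \<Rightarrow> 'a) \<Rightarrow> 'a \<Rightarrow> 'a set" where
  "full_orbit A T x = range (\<lambda>n. int_iterate A T n x)"

definition minimal_system :: "'a metric \<Rightarrow> ('a \<Rightarrow> 'a) \<Rightarrow> bool" where
  "minimal_system X T \<longleftrightarrow> dynamical_system X T \<and>
     (\<forall>x\<in>mspace X. mtopology_of X closure_of full_orbit (mspace X) T x = mspace X)"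

definition minimal_subset :: "'a metric \<Rightarrow> ('a \<Rightarrow> 'a) \<Rightarrow> 'a set \<Rightarrow> bool" where
  "minimal_subset X T M \<longleftrightarrow> M \<noteq> {} \<and> closedin (mtopology_of X) M \<and> T ` M = M \<and>
     (\<forall>x\<in>M. subtopology (mtopology_of X) M closure_of full_orbit (mspace X) T x = M)"

definition factor_map ::
    "'a metric \<Rightarrow> ('a \<Rightarrow> 'a) \<Rightarrow> 'b metric \<Rightarrow> ('b \<Rightarrow> 'b) \<Rightarrow> ('a \<Rightarrow> 'b) \<Rightarrow> bool" where
  "factor_map X T Y S \<pi> \<longleftrightarrow> continuous_map (mtopology_of X) (mtopology_of Y) \<pi> \<and>
     \<pi> ` mspace X = mspace Y \<and> (\<forall>x\<in>mspace X. \<pi> (T x) = S (\<pi> x))"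

definition equicontinuous_system :: "'a metric \<Rightarrow> ('a \<Rightarrow> 'a) \<Rightarrow> bool" where
  "equicontinuous_system X T \<longleftrightarrow> dynamical_system X T \<and>
     (\<forall>\<epsilon>>0. \<exists>\<delta>>0. \<forall>x\<in>mspace X. \<forall>y\<in>mspace X. mdist X x y < \<delta> \<longrightarrow>
        (\<forall>n. mdist X (int_iterate (mspace X) T n x) (int_iterate (mspace X) T n y) < \<epsilon>))"

text \<open>
  HOL cannot quantify over the carrier type of the test system \<open>(W,Q)\<close>. Since \<open>W\<close> is an image of
  \<open>X\<close>, a choice of preimages makes it isomorphic to a system carried by a subset of the type of \<open>X\<close>,
  so it is enough to let \<open>W\<close> range over metric spaces on subsets of that type. The lemma
  \<open>max_common_equicontinuous_factor_universal\<close> below recovers the universal property for test systems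
  of every type.
\<close>

definition max_common_equicontinuous_factor ::
    "'a metric \<Rightarrow> ('a \<Rightarrow> 'a) \<Rightarrow> 'b metric \<Rightarrow> ('b \<Rightarrow> 'b) \<Rightarrow>
     'c metric \<Rightarrow> ('c \<Rightarrow> 'c) \<Rightarrow> ('a \<Rightarrow> 'c) \<Rightarrow> ('b \<Rightarrow> 'c) \<Rightarrow> bool" where
  "max_common_equicontinuous_factor X T Y S Z R \<alpha> \<beta> \<longleftrightarrow>
     equicontinuous_system Z R \<and> factor_map X T Z R \<alpha> \<and> factor_map Y S Z R \<beta> \<and>
     (\<forall>(W :: 'a metric) Q \<phi> \<psi>.
        equicontinuous_system W Q \<and> factor_map X T W Q \<phi> \<and> factor_map Y S W Q \<psi> \<longrightarrow>
        (\<exists>\<eta>\<^sub>1 \<eta>\<^sub>2. factor_map Z R W Q \<eta>\<^sub>1 \<and> factor_map Z R W Q \<eta>\<^sub>2 \<and>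
           (\<forall>x\<in>mspace X. \<phi> x = \<eta>\<^sub>1 (\<alpha> x)) \<and> (\<forall>y\<in>mspace Y. \<psi> y = \<eta>\<^sub>2 (\<beta> y))))"

text \<open>
  \<open>G\<close> makes the space \<open>Z\<close> a topological abelian group on which \<open>R\<close> is a translation. The abelian group
  is written multiplicatively, as in \<open>HOL-Algebra\<close>, so a difference \<open>a - b\<close> becomes
  \<open>a \<otimes>\<^bsub>G\<^esub> inv\<^bsub>G\<^esub> b\<close>.
\<close>

definition group_translation ::
    "'c metric \<Rightarrow> ('c \<Rightarrow> 'c) \<Rightarrow> ('c, 'm) monoid_scheme \<Rightarrow> bool" where
  "group_translation Z R G \<longleftrightarrow> comm_group G \<and> carrier G = mspace Z \<and>
     continuous_map (prod_topology (mtopology_of Z) (mtopology_of Z)) (mtopology_of Z)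
       (\<lambda>(a, b). a \<otimes>\<^bsub>G\<^esub> b) \<and>
     continuous_map (mtopology_of Z) (mtopology_of Z) (\<lambda>a. inv\<^bsub>G\<^esub> a) \<and>
     (\<exists>g\<in>carrier G. \<forall>z\<in>mspace Z. R z = z \<otimes>\<^bsub>G\<^esub> g)"

definition difference_map ::
    "('c, 'm) monoid_scheme \<Rightarrow> ('a \<Rightarrow> 'c) \<Rightarrow> ('b \<Rightarrow> 'c) \<Rightarrow> 'a \<times> 'b \<Rightarrow> 'c" where
  "difference_map G \<alpha> \<beta> = (\<lambda>(x, y). \<alpha> x \<otimes>\<^bsub>G\<^esub> inv\<^bsub>G\<^esub> (\<beta> y))"

definition fibre :: "'a metric \<Rightarrow> ('a \<Rightarrow> 'c) \<Rightarrow> 'c \<Rightarrow> 'a set" where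
  "fibre X \<gamma> z = {p \<in> mspace X. \<gamma> p = z}"

definition residual_in :: "'a topology \<Rightarrow> 'a set \<Rightarrow> bool" where
  "residual_in X \<Omega> \<longleftrightarrow> \<Omega> \<subseteq> topspace X \<and>
     (\<exists>\<U>. countable \<U> \<and> (\<forall>U\<in>\<U>. openin X U \<and> X closure_of U = topspace X) \<and>
        topspace X \<inter> \<Inter>\<U> \<subseteq> \<Omega>)"

text \<open>
  The maximal common equicontinuous factor is unique up to isomorphism, and being a factor of \<open>X\<close> it can
  be realized on a subset of the type of \<open>X\<close>. Passing to another realization, or to another group
  structure for which \<open>R\<close> is a translation, composes \<open>difference_map\<close> with a homeomorphism, so the
  condition on the fibres does not depend on the realization; the quantifier only fixes one.
\<close>

definition strongly_quasi_disjoint ::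
    "'a metric \<Rightarrow> ('a \<Rightarrow> 'a) \<Rightarrow> 'b metric \<Rightarrow> ('b \<Rightarrow> 'b) \<Rightarrow> bool" where
  "strongly_quasi_disjoint X T Y S \<longleftrightarrow>
     (\<exists>(Z :: 'a metric) R (G :: 'a monoid) \<alpha> \<beta>.
        max_common_equicontinuous_factor X T Y S Z R \<alpha> \<beta> \<and> group_translation Z R G \<and>
        (\<exists>\<Omega>. residual_in (mtopology_of Z) \<Omega> \<and>
           (\<forall>z\<in>\<Omega>. minimal_subset (prod_metric X Y) (map_prod T S)
              (fibre (prod_metric X Y) (difference_map G \<alpha> \<beta>) z))))"

lemma factor_map_compose:
  assumes "factor_map X T Y S f" "factor_map Y S Z R g"
  shows "factor_map X T Z R (g \<circ> f)"
proof -
  have "(g \<circ> f) ` mspace X = mspace Z"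
    using assms by (simp add: factor_map_def flip: image_image[of g f] image_comp)
  then show ?thesis
    using assms by (auto simp: factor_map_def intro: continuous_map_compose)
qed

lemma int_iterate_conj:
  assumes T: "bij_betw T A A" and f: "bij_betw f A B"
    and U: "\<And>a. a \<in> A \<Longrightarrow> U (f a) = f (T a)" and a: "a \<in> A"
  shows "int_iterate A T n a \<in> A \<and> int_iterate B U n (f a) = f (int_iterate A T n a)"
proof -
  have TA: "T x \<in> A" if "x \<in> A" for x using T that by (auto simp: bij_betw_def)
  have iA: "inv_into A T x \<in> A" if "x \<in> A" for x
    using T that by (metis bij_betw_def inv_into_into)
  have UB: "bij_betw U B B"
  proof -
    have "bij_betw (f \<circ> T \<circ> inv_into A f) B B"
      using T f by (meson bij_betw_inv_into bij_betw_trans)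
    moreover have "(f \<circ> T \<circ> inv_into A f) b = U b" if "b \<in> B" for b
      using that f U by (metis bij_betw_inv_into_right bij_betw_def comp_apply inv_into_into)
    ultimately show ?thesis by (simp cong: bij_betw_cong)
  qed
  have iU: "inv_into B U (f x) = f (inv_into A T x)" if "x \<in> A" for x
  proof -
    have "U (f (inv_into A T x)) = f x"
      using that U iA T by (simp add: bij_betw_inv_into_right)
    moreover have "f (inv_into A T x) \<in> B" using f iA that by (auto simp: bij_betw_def)
    ultimately show ?thesis using UB by (metis bij_betw_inv_into_left)
  qed
  have 1: "(T ^^ k) a \<in> A \<and> (U ^^ k) (f a) = f ((T ^^ k) a)" for k
    by (induction k) (use a TA U in auto)
  have 2: "(inv_into A T ^^ k) a \<in> A \<and> (inv_into B U ^^ k) (f a) = f ((inv_into A T ^^ k) a)" for k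
    by (induction k) (use a iA iU in auto)
  show ?thesis using 1 2 by (simp add: int_iterate_def)
qed

lemma max_common_equicontinuous_factor_universal:
  fixes W :: "'w metric"
  assumes Z: "max_common_equicontinuous_factor X T Y S Z R \<alpha> \<beta>"
    and W: "equicontinuous_system W Q"
    and \<phi>: "factor_map X T W Q \<phi>" and \<psi>: "factor_map Y S W Q \<psi>"
  shows "\<exists>\<eta>\<^sub>1 \<eta>\<^sub>2. factor_map Z R W Q \<eta>\<^sub>1 \<and> factor_map Z R W Q \<eta>\<^sub>2 \<and>
           (\<forall>x\<in>mspace X. \<phi> x = \<eta>\<^sub>1 (\<alpha> x)) \<and> (\<forall>y\<in>mspace Y. \<psi> y = \<eta>\<^sub>2 (\<beta> y))"
proof -
  define s where "s = inv_into (mspace X) \<phi>"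
  define V where "V = metric (s ` mspace W, \<lambda>a b. mdist W (\<phi> a) (\<phi> b))"
  define P where "P = s \<circ> Q \<circ> \<phi>"
  have \<phi>s: "\<phi> (s w) = w" if "w \<in> mspace W" for w
    using that \<phi> unfolding s_def factor_map_def by (metis f_inv_into_f)
  have ms: "Metric_space (s ` mspace W) (\<lambda>a b. mdist W (\<phi> a) (\<phi> b))"
    by unfold_locales (auto simp: mdist_commute \<phi>s intro: mdist_triangle)
  have V: "mspace V = s ` mspace W" "mdist V = (\<lambda>a b. mdist W (\<phi> a) (\<phi> b))"
    using Metric_space.mspace_metric[OF ms] Metric_space.mdist_metric[OF ms] by (auto simp: V_def)
  have cs: "continuous_map (mtopology_of W) (mtopology_of V) s"
    by (intro Lipschitz_continuous_imp_continuous_map)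
      (auto simp: Lipschitz_continuous_map_def V \<phi>s intro!: exI[of _ 1])
  have c\<phi>: "continuous_map (mtopology_of V) (mtopology_of W) \<phi>"
    by (intro Lipschitz_continuous_imp_continuous_map)
      (auto simp: Lipschitz_continuous_map_def V \<phi>s intro!: exI[of _ 1])
  have hs: "homeomorphic_maps (mtopology_of W) (mtopology_of V) s \<phi>"
    using cs c\<phi> by (auto simp: homeomorphic_maps_def V \<phi>s)
  have hQ: "homeomorphic_map (mtopology_of W) (mtopology_of W) Q"
    and cW: "compact_space (mtopology_of W)"
    using W by (auto simp: equicontinuous_system_def dynamical_system_def)
  have QW: "Q w \<in> mspace W" if "w \<in> mspace W" for w
    using hQ that by (metis homeomorphic_imp_surjective_map image_eqI topspace_mtopology_of)
  have bQ: "bij_betw Q (mspace W) (mspace W)"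
    using hQ by (metis bij_betw_def homeomorphic_imp_injective_map homeomorphic_imp_surjective_map
        topspace_mtopology_of)
  have bs: "bij_betw s (mspace W) (s ` mspace W)"
    by (intro inj_on_imp_bij_betw inj_on_inverseI[of _ \<phi>] \<phi>s)
  have Ps: "P (s w) = s (Q w)" if "w \<in> mspace W" for w
    using that by (simp add: P_def \<phi>s)
  have it: "int_iterate (mspace W) Q n w \<in> mspace W"
    "int_iterate (mspace V) P n (s w) = s (int_iterate (mspace W) Q n w)" if "w \<in> mspace W" for n w
    using int_iterate_conj[OF bQ bs Ps that] by (auto simp: V)
  have hs': "homeomorphic_map (mtopology_of W) (mtopology_of V) s"
    "homeomorphic_map (mtopology_of V) (mtopology_of W) \<phi>"
    using hs homeomorphic_maps_sym homeomorphic_map_maps by blast+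
  have dV: "dynamical_system V P"
    unfolding dynamical_system_def
  proof
    show "compact_space (mtopology_of V)"
      using homeomorphic_compact_space[OF homeomorphic_map_imp_homeomorphic_space[OF hs'(1)]] cW
      by simp
    show "homeomorphic_map (mtopology_of V) (mtopology_of V) P"
      unfolding P_def comp_assoc
      by (rule homeomorphic_map_compose[OF homeomorphic_map_compose[OF hs'(2) hQ] hs'(1)])
  qed
  have eV: "equicontinuous_system V P"
    unfolding equicontinuous_system_def
  proof (intro conjI dV allI impI)
    fix \<epsilon> :: real assume "\<epsilon> > 0"
    then obtain \<delta> where "\<delta> > 0" and \<delta>: "\<And>x y n. \<lbrakk>x \<in> mspace W; y \<in> mspace W; mdist W x y < \<delta>\<rbrakk> \<Longrightarrow>
        mdist W (int_iterate (mspace W) Q n x) (int_iterate (mspace W) Q n y) < \<epsilon>"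
      using W unfolding equicontinuous_system_def by metis
    have "\<forall>x\<in>mspace V. \<forall>y\<in>mspace V. mdist V x y < \<delta> \<longrightarrow>
        (\<forall>n. mdist V (int_iterate (mspace V) P n x) (int_iterate (mspace V) P n y) < \<epsilon>)"
    proof (intro ballI impI allI)
      fix x y n assume "x \<in> mspace V" "y \<in> mspace V" "mdist V x y < \<delta>"
      then obtain w w' where w: "w \<in> mspace W" "x = s w" "w' \<in> mspace W" "y = s w'"
        "mdist W w w' < \<delta>" by (auto simp: V \<phi>s)
      then show "mdist V (int_iterate (mspace V) P n x) (int_iterate (mspace V) P n y) < \<epsilon>"
        using \<delta>[of w w' n] it[of w n] it[of w' n] by (simp add: V(2) \<phi>s)
    qed
    then show "\<exists>\<delta>>0. \<forall>x\<in>mspace V. \<forall>y\<in>mspace V. mdist V x y < \<delta> \<longrightarrow>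
        (\<forall>n. mdist V (int_iterate (mspace V) P n x) (int_iterate (mspace V) P n y) < \<epsilon>)"
      using \<open>\<delta> > 0\<close> by blast
  qed
  have fs: "factor_map W Q V P s"
    using cs by (auto simp: factor_map_def V Ps)
  have f\<phi>: "factor_map V P W Q \<phi>"
    using c\<phi> by (auto simp: factor_map_def V Ps \<phi>s QW image_image)
  obtain \<eta>\<^sub>1 \<eta>\<^sub>2 where \<eta>: "factor_map Z R V P \<eta>\<^sub>1" "factor_map Z R V P \<eta>\<^sub>2"
    "\<forall>x\<in>mspace X. (s \<circ> \<phi>) x = \<eta>\<^sub>1 (\<alpha> x)" "\<forall>y\<in>mspace Y. (s \<circ> \<psi>) y = \<eta>\<^sub>2 (\<beta> y)"
    using Z eV factor_map_compose[OF \<phi> fs] factor_map_compose[OF \<psi> fs]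
    unfolding max_common_equicontinuous_factor_def by metis
  have img: "\<forall>x\<in>mspace X. \<phi> x \<in> mspace W" "\<forall>y\<in>mspace Y. \<psi> y \<in> mspace W"
    using \<phi> \<psi> by (auto simp: factor_map_def)
  show ?thesis
  proof (intro exI conjI ballI)
    show "factor_map Z R W Q (\<phi> \<circ> \<eta>\<^sub>1)" "factor_map Z R W Q (\<phi> \<circ> \<eta>\<^sub>2)"
      using \<eta> f\<phi> factor_map_compose by blast+
    show "\<phi> x = (\<phi> \<circ> \<eta>\<^sub>1) (\<alpha> x)" if "x \<in> mspace X" for x
      using that \<eta>(3) img \<phi>s by (metis comp_apply)
    show "\<psi> y = (\<phi> \<circ> \<eta>\<^sub>2) (\<beta> y)" if "y \<in> mspace Y" for y
      using that \<eta>(4) img \<phi>s by (metis comp_apply)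
  qed
qed

end

theory Submission
  imports Defs
begin

text \<open>
  The map \<open>\<gamma>\<close> is invariant under \<open>T \<times> S\<close>, and \<open>T \<times> id\<close> carries the fibre over \<open>z\<close> onto the fibre over
  \<open>R z\<close>. Hence the set of values with minimal fibre is \<open>R\<close>-invariant, so it is dense as soon as it is
  nonempty. Compactness makes it a \<open>G\<^sub>\<delta>\<close>, and by Baire's theorem a residual set of values is
  nonempty. The partition of \<open>X \<times> Y\<close> into fibres of \<open>\<gamma>\<close> does not depend on the chosen
  realization of the maximal common equicontinuous factor, nor on its group structure, because
  \<open>\<eta>\<^sub>1 z - \<eta>\<^sub>2 w\<close> depends on \<open>z - w\<close> only for any two homomorphisms \<open>\<eta>\<^sub>1, \<eta>\<^sub>2\<close> between minimal
  translations.
\<close>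

section \<open>Iterates, invariant sets and minimal subsets\<close>

lemma dynamical_system_bij_betw:
  assumes "dynamical_system X T"
  shows "bij_betw T (mspace X) (mspace X)"
  using assms unfolding dynamical_system_def bij_betw_def
  by (metis homeomorphic_imp_injective_map homeomorphic_imp_surjective_map topspace_mtopology_of)

text \<open>Negative iterates are the reason for requiring that the image of \<open>M\<close> equals
  \<open>M\<close>: a point of \<open>M\<close> is then \<open>T w\<close> with \<open>w\<close> in
  \<open>M\<close>, and injectivity on \<open>A\<close> identifies \<open>w\<close> as the value of
  \<open>inv_into A T\<close>.\<close>

lemma int_iterate_in_invariant:
  assumes T: "bij_betw T A A" and M: "M \<subseteq> A" "T ` M = M" and x: "x \<in> M"
  shows "int_iterate A T n x \<in> M"
proof -
  have "T y \<in> M" if "y \<in> M" for y using that M by auto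
  then have 1: "(T ^^ k) x \<in> M" for k
    by (induction k) (use x in auto)
  have "inv_into A T y \<in> M" if y: "y \<in> M" for y
  proof -
    obtain w where "w \<in> M" "y = T w" using y M by auto
    then show ?thesis using T M by (metis bij_betw_inv_into_left subsetD)
  qed
  then have 2: "(inv_into A T ^^ k) x \<in> M" for k
    by (induction k) (use x in auto)
  show ?thesis using 1 2 by (simp add: int_iterate_def)
qed

lemma full_orbit_subset:
  assumes "bij_betw T A A" "M \<subseteq> A" "T ` M = M" "x \<in> M"
  shows "full_orbit A T x \<subseteq> M"
  using int_iterate_in_invariant[OF assms] by (auto simp: full_orbit_def)

lemma continuous_map_int_iterate:
  assumes "dynamical_system X T"
  shows "continuous_map (mtopology_of X) (mtopology_of X) (int_iterate (mspace X) T n)"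
proof -
  let ?\<tau> = "mtopology_of X"
  have pow: "continuous_map ?\<tau> ?\<tau> (f ^^ k)" if "continuous_map ?\<tau> ?\<tau> f" for f k
    by (induction k) (use that continuous_map_compose in \<open>auto simp: id_def[symmetric] comp_def\<close>)
  obtain g where g: "homeomorphic_maps ?\<tau> ?\<tau> T g"
    using assms by (auto simp: dynamical_system_def homeomorphic_map_maps)
  \<comment> \<open>On the space, \<open>inv_into\<close> agrees with the continuous inverse
    \<open>g\<close>, which is how continuity reaches the negative iterates.\<close>
  have "inv_into (mspace X) T y = g y" if "y \<in> mspace X" for y
    using g that dynamical_system_bij_betw[OF assms] unfolding homeomorphic_maps_def
    by (metis bij_betw_inv_into_left continuous_map_image_subset_topspace image_subset_iff
        topspace_mtopology_of)
  then have "continuous_map ?\<tau> ?\<tau> (inv_into (mspace X) T)"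
    using g by (auto simp: homeomorphic_maps_def intro: continuous_map_eq)
  moreover have "continuous_map ?\<tau> ?\<tau> T"
    using g by (simp add: homeomorphic_maps_def)
  ultimately show ?thesis by (auto simp: int_iterate_def pow)
qed

lemma invariant_image_eq:
  assumes "bij_betw T A A" "C \<subseteq> A" "\<And>y. y \<in> A \<Longrightarrow> T y \<in> C \<longleftrightarrow> y \<in> C"
  shows "T ` C = C"
proof
  show "T ` C \<subseteq> C" using assms by auto
  show "C \<subseteq> T ` C"
  proof
    fix y assume "y \<in> C"
    then obtain w where "w \<in> A" "y = T w" using assms(1,2) by (auto simp: bij_betw_def)
    then show "y \<in> T ` C" using assms(3) \<open>y \<in> C\<close> by auto
  qed
qed

text \<open>The full orbit of \<open>x\<close> stays in the closed set \<open>C\<close> and is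
  dense. Invariance is stated pointwise because preimages under factor maps satisfy it in this
  form.\<close>

lemma minimal_system_closed_invariant:
  assumes X: "minimal_system X T" and C: "closedin (mtopology_of X) C" and x: "x \<in> C"
    and inv: "\<And>y. y \<in> mspace X \<Longrightarrow> T y \<in> C \<longleftrightarrow> y \<in> C"
  shows "C = mspace X"
proof
  show CX: "C \<subseteq> mspace X" using closedin_subset[OF C] by simp
  have T: "bij_betw T (mspace X) (mspace X)"
    using X by (simp add: minimal_system_def dynamical_system_bij_betw)
  have "full_orbit (mspace X) T x \<subseteq> C"
    using full_orbit_subset[OF T CX invariant_image_eq[OF T CX inv] x] by simp
  then have "mtopology_of X closure_of full_orbit (mspace X) T x \<subseteq> C"
    using C by (rule closure_of_minimal)
  then show "mspace X \<subseteq> C"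
    using X CX x unfolding minimal_system_def by blast
qed

text \<open>Orbits of points of a closed invariant \<open>M\<close> stay in \<open>M\<close>, so the
  closure in the subspace is the trace on \<open>M\<close> of the closure in the whole space, and
  equality with \<open>M\<close> reduces to one inclusion.\<close>

lemma minimal_subset_iff:
  assumes T: "bij_betw T (mspace X) (mspace X)"
  shows "minimal_subset X T M \<longleftrightarrow> M \<noteq> {} \<and> closedin (mtopology_of X) M \<and> T ` M = M \<and>
    (\<forall>x\<in>M. M \<subseteq> mtopology_of X closure_of full_orbit (mspace X) T x)"
proof -
  have "subtopology (mtopology_of X) M closure_of full_orbit (mspace X) T x = M \<longleftrightarrow>
      M \<subseteq> mtopology_of X closure_of full_orbit (mspace X) T x"
    if "closedin (mtopology_of X) M" "T ` M = M" "x \<in> M" for x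
  proof -
    have "full_orbit (mspace X) T x \<subseteq> M"
      using closedin_subset[OF that(1)] that by (intro full_orbit_subset[OF T]) auto
    then show ?thesis by (auto simp: closure_of_subtopology Int_absorb1)
  qed
  then show ?thesis unfolding minimal_subset_def by blast
qed

text \<open>A homeomorphism commuting with \<open>T\<close> maps orbits to orbits and their closures
  to closures. This is what moves minimality from one fibre of \<gamma> to another.\<close>

lemma minimal_subset_image_iff:
  assumes T: "bij_betw T (mspace X) (mspace X)"
    and H: "homeomorphic_map (mtopology_of X) (mtopology_of X) H"
    and comm: "\<And>x. x \<in> mspace X \<Longrightarrow> T (H x) = H (T x)"
    and M: "M \<subseteq> mspace X"
  shows "minimal_subset X T (H ` M) \<longleftrightarrow> minimal_subset X T M"
proof -
  let ?\<tau> = "mtopology_of X" and ?O = "full_orbit (mspace X) T"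
  have injH: "inj_on H (mspace X)" and HX: "H ` mspace X = mspace X"
    using homeomorphic_imp_injective_map[OF H] homeomorphic_imp_surjective_map[OF H] by auto
  have TM: "T ` M \<subseteq> mspace X" using T M by (auto simp: bij_betw_def)
  have "T ` H ` M = H ` T ` M"
    using comm M by (force simp: image_image)
  then have inv: "T ` H ` M = H ` M \<longleftrightarrow> T ` M = M"
    using inj_on_image_eq_iff[OF injH TM M] by simp
  have orb: "?O (H x) = H ` ?O x" "?O x \<subseteq> mspace X" if "x \<in> mspace X" for x
  proof -
    have "bij_betw H (mspace X) (mspace X)" using injH HX by (simp add: bij_betw_def)
    then have "int_iterate (mspace X) T n x \<in> mspace X \<and>
        int_iterate (mspace X) T n (H x) = H (int_iterate (mspace X) T n x)" for n
      using int_iterate_conj[where f = H and U = T] T comm that by blast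
    then show "?O (H x) = H ` ?O x" "?O x \<subseteq> mspace X"
      by (auto simp: full_orbit_def image_image)
  qed
  have "H ` M \<subseteq> ?\<tau> closure_of ?O (H x) \<longleftrightarrow> M \<subseteq> ?\<tau> closure_of ?O x" if "x \<in> M" for x
  proof -
    have x: "x \<in> mspace X" using that M by auto
    have "?\<tau> closure_of ?O (H x) = H ` (?\<tau> closure_of ?O x)"
      using homeomorphic_map_closure_of[OF H] orb[OF x] by simp
    then show ?thesis
      using inj_on_image_subset_iff[OF injH M] closure_of_subset_topspace[of ?\<tau> "?O x"] by simp
  qed
  moreover have "closedin ?\<tau> (H ` M) \<longleftrightarrow> closedin ?\<tau> M"
    using homeomorphic_map_closedness[OF H] M by simp
  ultimately show ?thesis
    using inv by (auto simp: minimal_subset_iff[OF T])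
qed

section \<open>Closures in metric form and products of systems\<close>

lemma closure_of_mdist:
  "mtopology_of X closure_of A = {x \<in> mspace X. \<forall>r>0. \<exists>y\<in>A. y \<in> mspace X \<and> mdist X x y < r}"
  using Metric_space.metric_closure_of[OF Metric_space_mspace_mdist, of X A]
  by (auto simp: mtopology_of_def Metric_space.in_mball[OF Metric_space_mspace_mdist])

lemma homeomorphic_map_map_prod:
  assumes "homeomorphic_map X X' f" "homeomorphic_map Y Y' g"
  shows "homeomorphic_map (prod_topology X Y) (prod_topology X' Y') (map_prod f g)"
proof -
  obtain f' g' where "homeomorphic_maps X X' f f'" "homeomorphic_maps Y Y' g g'"
    using assms by (auto simp: homeomorphic_map_maps)
  then have "homeomorphic_maps (prod_topology X Y) (prod_topology X' Y')
      (\<lambda>(x, y). (f x, g y)) (\<lambda>(x, y). (f' x, g' y))"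
    by (simp add: homeomorphic_maps_prod)
  then show ?thesis
    unfolding homeomorphic_map_maps map_prod_def by blast
qed

lemma dynamical_system_prod:
  assumes "dynamical_system X T" "dynamical_system Y S"
  shows "dynamical_system (prod_metric X Y) (map_prod T S)"
  using assms
  by (simp add: dynamical_system_def homeomorphic_map_map_prod compact_space_prod_topology)

section \<open>The values with minimal fibre form a G-delta set\<close>

text \<open>
  A fibre fails to be minimal iff, for some \<open>k\<close>, it contains \<open>p, q\<close> such that the orbit of \<open>p\<close> stays
  at distance at least \<open>1/k\<close> from \<open>q\<close>. These pairs form a compact set for each \<open>k\<close>, so the exceptional
  values form a countable union of closed sets.
\<close>

lemma gdelta_in_minimal_fibres:
  assumes F: "dynamical_system P F" and Z: "Hausdorff_space (mtopology_of Z)"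
    and \<gamma>: "continuous_map (mtopology_of P) (mtopology_of Z) \<gamma>" "\<gamma> ` mspace P = mspace Z"
    and inv: "\<And>p. p \<in> mspace P \<Longrightarrow> \<gamma> (F p) = \<gamma> p"
  shows "gdelta_in (mtopology_of Z) {z \<in> mspace Z. minimal_subset P F (fibre P \<gamma> z)}"
proof -
  let ?\<tau> = "mtopology_of P" and ?\<zeta> = "mtopology_of Z" and ?it = "int_iterate (mspace P) F"
  let ?PP = "prod_topology ?\<tau> ?\<tau>"
  note bF = dynamical_system_bij_betw[OF F]
  \<comment> \<open>\<open>Suc k\<close> keeps the bound positive: with \<open>k\<close> in its
    place, \<open>1 / 0 = 0\<close> would put every pair of points with equal \<gamma>-value into
    \<open>K 0\<close>.\<close>
  define K where "K k = {pq \<in> topspace ?PP. \<gamma> (fst pq) = \<gamma> (snd pq) \<and>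
      (\<forall>n. mdist P (snd pq) (?it n (fst pq)) \<ge> 1 / real (Suc k))}" for k
  define B where "B k = (\<gamma> \<circ> fst) ` K k" for k
  have minimal: "minimal_subset P F (fibre P \<gamma> z) \<longleftrightarrow> (\<forall>k. z \<notin> B k)" if z: "z \<in> mspace Z" for z
  proof -
    let ?M = "fibre P \<gamma> z"
    have "?M = {p \<in> topspace ?\<tau>. \<gamma> p \<in> {z}}" by (auto simp: fibre_def)
    then have clM: "closedin ?\<tau> ?M"
      using closedin_continuous_map_preimage[OF \<gamma>(1), of "{z}"] Z z
      by (simp add: closedin_Hausdorff_singleton)
    have MP: "?M \<subseteq> mspace P" by (auto simp: fibre_def)
    have FM: "F ` ?M = ?M"
      by (rule invariant_image_eq[OF bF MP]) (use bF inv in \<open>auto simp: fibre_def bij_betw_def\<close>)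
    have ne: "?M \<noteq> {}" using \<gamma>(2) z by (force simp: fibre_def)
    have it: "?it n p \<in> mspace P" if "p \<in> mspace P" for n p
      using that int_iterate_in_invariant[OF bF subset_refl] bF by (auto simp: bij_betw_def)
    have "minimal_subset P F ?M \<longleftrightarrow>
        (\<forall>p\<in>?M. \<forall>q\<in>?M. \<forall>r>0. \<exists>n. mdist P q (?it n p) < r)"
      using clM FM ne MP it
      by (auto simp: minimal_subset_iff[OF bF] closure_of_mdist full_orbit_def subset_iff)
    also have "\<dots> \<longleftrightarrow> (\<forall>p\<in>?M. \<forall>q\<in>?M. \<forall>k. \<exists>n. mdist P q (?it n p) < 1 / real (Suc k))"
    proof (intro ball_cong refl iffI allI impI)
      fix p q and r :: real assume *: "\<forall>k. \<exists>n. mdist P q (?it n p) < 1 / real (Suc k)" and "r > 0"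
      then obtain k where "1 / real (Suc k) < r" using nat_approx_posE by blast
      then show "\<exists>n. mdist P q (?it n p) < r" using * by (meson less_trans)
    qed auto
    also have "\<dots> \<longleftrightarrow> (\<forall>k. z \<notin> B k)"
      unfolding B_def K_def fibre_def by (auto simp: not_le image_iff) (metis not_le)+
    finally show ?thesis .
  qed
  have "openin ?\<zeta> (mspace Z - B k)" for k
  proof -
    have "closedin ?PP {pq \<in> topspace ?PP. \<gamma> (fst pq) = \<gamma> (snd pq)}"
      by (rule closedin_continuous_maps_eq[OF Z])
        (use continuous_map_compose[OF continuous_map_fst \<gamma>(1)]
          continuous_map_compose[OF continuous_map_snd \<gamma>(1)] in \<open>simp_all add: comp_def\<close>)
    moreover have "closedin ?PP {pq \<in> topspace ?PP.
        mdist P (snd pq) (?it n (fst pq)) \<in> {1 / real (Suc k)..}}" for n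
      using continuous_map_compose[OF continuous_map_fst continuous_map_int_iterate[OF F]]
      by (intro closedin_continuous_map_preimage[where Y = euclideanreal] continuous_map_mdist
          continuous_map_snd) (auto simp: comp_def)
    ultimately have "closedin ?PP ({pq \<in> topspace ?PP. \<gamma> (fst pq) = \<gamma> (snd pq)} \<inter>
        (\<Inter>n. {pq \<in> topspace ?PP. mdist P (snd pq) (?it n (fst pq)) \<in> {1 / real (Suc k)..}}))"
      by (intro closedin_Int closedin_INT) auto
    also have "\<dots> = K k" by (auto simp: K_def)
    finally have "compactin ?PP (K k)"
      using F by (intro closedin_compact_space)
        (auto simp: dynamical_system_def compact_space_prod_topology)
    \<comment> \<open>Compactness, unlike closedness, passes to the continuous image, and a compact
      subset of the Hausdorff space \<open>Z\<close> is closed.\<close>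
    then have "compactin ?\<zeta> (B k)"
      unfolding B_def
      by (rule image_compactin) (rule continuous_map_compose[OF continuous_map_fst \<gamma>(1)])
    then have "closedin ?\<zeta> (B k)" using Z compactin_imp_closedin by blast
    then show ?thesis by (metis openin_diff openin_topspace topspace_mtopology_of)
  qed
  then have "gdelta_in ?\<zeta> (\<Inter>k. mspace Z - B k)"
    by (intro gdelta_in_Inter) (auto intro: open_imp_gdelta_in)
  also have "(\<Inter>k. mspace Z - B k) = {z \<in> mspace Z. minimal_subset P F (fibre P \<gamma> z)}"
    using minimal by auto
  finally show ?thesis .
qed

section \<open>The difference map onto a group translation\<close>

text \<open>Collects what the fibre argument uses of one realization of the common factor together
  with a group structure, so that several realizations can be instantiated side by side and
  compared.\<close>

locale common_translation_factor =
  fixes X :: "'a metric" and T :: "'a \<Rightarrow> 'a" and Y :: "'b metric" and S :: "'b \<Rightarrow> 'b"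
    and Z :: "'c metric" and R :: "'c \<Rightarrow> 'c" and G :: "('c, 'm) monoid_scheme" (structure)
    and \<alpha> :: "'a \<Rightarrow> 'c" and \<beta> :: "'b \<Rightarrow> 'c"
  assumes minimal_X: "minimal_system X T" and minimal_Y: "minimal_system Y S"
    and system_Z: "dynamical_system Z R"
    and factor_\<alpha>: "factor_map X T Z R \<alpha>" and factor_\<beta>: "factor_map Y S Z R \<beta>"
    and translation: "group_translation Z R G"
begin

abbreviation "\<gamma> \<equiv> difference_map G \<alpha> \<beta>"

sublocale comm_group G
  using translation by (simp add: group_translation_def)

lemma carrier_eq [simp]: "carrier G = mspace Z"
  using translation by (simp add: group_translation_def)

text \<open>The simp rule \<open>carrier_eq\<close> eliminates \<open>carrier G\<close> from goals,
  so the closure rules have to speak of \<open>mspace Z\<close>.\<close>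

lemmas mspace_closed [simp] =
  m_closed[unfolded carrier_eq] inv_closed[unfolded carrier_eq] one_closed[unfolded carrier_eq]

lemma \<alpha>_closed: "x \<in> mspace X \<Longrightarrow> \<alpha> x \<in> mspace Z"
  and \<beta>_closed: "y \<in> mspace Y \<Longrightarrow> \<beta> y \<in> mspace Z"
  using factor_\<alpha> factor_\<beta> by (auto simp: factor_map_def)

lemma ex_translation_element:
  obtains g where "g \<in> mspace Z" "\<And>z. z \<in> mspace Z \<Longrightarrow> R z = z \<otimes> g"
  using translation by (auto simp: group_translation_def)

lemma Hausdorff_Z: "Hausdorff_space (mtopology_of Z)"
  by (simp add: mtopology_of_def Metric_space.Hausdorff_space_mtopology)

lemma continuous_map_group_mult:
  assumes "continuous_map W (mtopology_of Z) f" "continuous_map W (mtopology_of Z) h"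
  shows "continuous_map W (mtopology_of Z) (\<lambda>w. f w \<otimes> h w)"
  using continuous_map_compose[OF continuous_map_pairedI[OF assms]] translation
  by (fastforce simp: group_translation_def comp_def)

lemma continuous_map_group_diff:
  assumes "continuous_map W (mtopology_of Z) f" "continuous_map W (mtopology_of Z) h"
  shows "continuous_map W (mtopology_of Z) (\<lambda>w. f w \<otimes> inv (h w))"
  using continuous_map_group_mult[OF assms(1)] continuous_map_compose[OF assms(2)] translation
  by (fastforce simp: group_translation_def comp_def)

lemma T_closed: "x \<in> mspace X \<Longrightarrow> T x \<in> mspace X"
  and S_closed: "y \<in> mspace Y \<Longrightarrow> S y \<in> mspace Y"
  using minimal_X minimal_Y dynamical_system_bij_betw
  by (force simp: minimal_system_def bij_betw_def)+

text \<open>Minimality of \<open>Z\<close>, inherited from \<open>X\<close>: the preimage of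
  \<open>C\<close> under \<alpha> is closed, invariant and nonempty, hence all of \<open>X\<close>,
  and \<alpha> is onto.\<close>

lemma Z_closed_invariant:
  assumes C: "closedin (mtopology_of Z) C" "z \<in> C"
    and inv: "\<And>z. z \<in> mspace Z \<Longrightarrow> R z \<in> C \<longleftrightarrow> z \<in> C"
  shows "C = mspace Z"
proof -
  let ?D = "{x \<in> topspace (mtopology_of X). \<alpha> x \<in> C}"
  have \<alpha>: "continuous_map (mtopology_of X) (mtopology_of Z) \<alpha>" "\<alpha> ` mspace X = mspace Z"
      "\<And>x. x \<in> mspace X \<Longrightarrow> \<alpha> (T x) = R (\<alpha> x)"
    using factor_\<alpha> by (auto simp: factor_map_def)
  have CZ: "C \<subseteq> mspace Z" using closedin_subset[OF C(1)] by simp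
  then obtain x where "x \<in> ?D" using C(2) \<alpha>(2) by (force simp: image_iff)
  then have "?D = mspace X"
    using closedin_continuous_map_preimage[OF \<alpha>(1) C(1)] inv \<alpha>(3) \<alpha>_closed T_closed
    by (intro minimal_system_closed_invariant[OF minimal_X]) auto
  then have "\<alpha> ` mspace X \<subseteq> C" by auto
  then show ?thesis using \<alpha>(2) CZ by simp
qed

lemma \<gamma>_continuous: "continuous_map (prod_topology (mtopology_of X) (mtopology_of Y)) (mtopology_of Z) \<gamma>"
proof -
  let ?P = "prod_topology (mtopology_of X) (mtopology_of Y)"
  have "continuous_map (mtopology_of X) (mtopology_of Z) \<alpha>"
    "continuous_map (mtopology_of Y) (mtopology_of Z) \<beta>"
    using factor_\<alpha> factor_\<beta> by (simp_all add: factor_map_def)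
  then have "continuous_map ?P (mtopology_of Z) (\<alpha> \<circ> fst)"
    "continuous_map ?P (mtopology_of Z) (\<beta> \<circ> snd)"
    by (simp_all add: continuous_map_compose[OF continuous_map_fst]
        continuous_map_compose[OF continuous_map_snd])
  then have "continuous_map ?P (mtopology_of Z) (\<lambda>p. (\<alpha> \<circ> fst) p \<otimes> inv ((\<beta> \<circ> snd) p))"
    by (rule continuous_map_group_diff)
  then show ?thesis by (simp add: difference_map_def case_prod_unfold)
qed

lemma \<gamma>_surj: "\<gamma> ` (mspace X \<times> mspace Y) = mspace Z"
proof
  show "\<gamma> ` (mspace X \<times> mspace Y) \<subseteq> mspace Z"
    using \<alpha>_closed \<beta>_closed by (auto simp: difference_map_def)
  show "mspace Z \<subseteq> \<gamma> ` (mspace X \<times> mspace Y)"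
  proof
    fix z assume z: "z \<in> mspace Z"
    \<comment> \<open>Over the unit the second coordinate contributes nothing, so surjectivity of
      \<alpha> suffices.\<close>
    have "\<one> \<in> \<beta> ` mspace Y" using factor_\<beta> one_closed by (simp add: factor_map_def)
    then obtain y where y: "y \<in> mspace Y" "\<beta> y = \<one>" by auto
    have "z \<in> \<alpha> ` mspace X" using factor_\<alpha> z by (simp add: factor_map_def)
    then obtain x where "x \<in> mspace X" "\<alpha> x = z" by auto
    then have "\<gamma> (x, y) = z" using y z by (simp add: difference_map_def)
    then show "z \<in> \<gamma> ` (mspace X \<times> mspace Y)" using \<open>x \<in> mspace X\<close> y by force
  qed
qed

text \<open>Only the first coordinate moves, so the translation by \<open>g\<close> survives in the
  difference.\<close>

lemma \<gamma>_T_id: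
  assumes "x \<in> mspace X" "y \<in> mspace Y"
  shows "\<gamma> (T x, y) = R (\<gamma> (x, y))"
proof -
  obtain g where g: "g \<in> mspace Z" "\<And>z. z \<in> mspace Z \<Longrightarrow> R z = z \<otimes> g"
    using ex_translation_element by blast
  have "\<alpha> (T x) = \<alpha> x \<otimes> g" using factor_\<alpha> assms g \<alpha>_closed by (simp add: factor_map_def)
  then show ?thesis
    using assms g \<alpha>_closed \<beta>_closed by (simp add: difference_map_def m_ac)
qed

text \<open>Both coordinates are translated by the same \<open>g\<close>, which cancels in the
  difference.\<close>

lemma \<gamma>_invariant:
  assumes "x \<in> mspace X" "y \<in> mspace Y"
  shows "\<gamma> (T x, S y) = \<gamma> (x, y)"
proof -
  obtain g where g: "g \<in> mspace Z" "\<And>z. z \<in> mspace Z \<Longrightarrow> R z = z \<otimes> g"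
    using ex_translation_element by blast
  have "\<alpha> (T x) = \<alpha> x \<otimes> g" "\<beta> (S y) = \<beta> y \<otimes> g"
    using factor_\<alpha> factor_\<beta> assms g \<alpha>_closed \<beta>_closed by (simp_all add: factor_map_def)
  \<comment> \<open>The cancellation in the shape that \<open>m_assoc\<close> and
    \<open>inv_mult\<close> produce.\<close>
  moreover have "g \<otimes> (inv (\<beta> y) \<otimes> inv g) = inv (\<beta> y)"
    using g assms \<beta>_closed by (simp add: m_lcomm[of g])
  ultimately show ?thesis
    using assms g \<alpha>_closed \<beta>_closed
    by (simp add: difference_map_def m_assoc inv_mult)
qed

section \<open>Invariance and density of the values with minimal fibre\<close>

text \<open>The largest set of values that can serve as \<Omega>, both as a dense G-delta set and as
  a residual set.\<close>

definition minimal_values :: "'c set" where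
  "minimal_values = {z \<in> mspace Z.
     minimal_subset (prod_metric X Y) (map_prod T S) (fibre (prod_metric X Y) \<gamma> z)}"

lemma R_homeomorphic: "homeomorphic_map (mtopology_of Z) (mtopology_of Z) R"
  using system_Z by (simp add: dynamical_system_def)

lemma system_prod: "dynamical_system (prod_metric X Y) (map_prod T S)"
  using minimal_X minimal_Y by (simp add: minimal_system_def dynamical_system_prod)

lemma gdelta_in_minimal_values: "gdelta_in (mtopology_of Z) minimal_values"
  unfolding minimal_values_def
  using system_prod Hausdorff_Z
proof (rule gdelta_in_minimal_fibres)
  show "continuous_map (mtopology_of (prod_metric X Y)) (mtopology_of Z) \<gamma>"
    using \<gamma>_continuous by simp
  show "\<gamma> ` mspace (prod_metric X Y) = mspace Z"
    using \<gamma>_surj by simp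
  show "\<gamma> (map_prod T S p) = \<gamma> p" if "p \<in> mspace (prod_metric X Y)" for p
    using that by (cases p) (simp add: \<gamma>_invariant)
qed

lemma minimal_values_invariant:
  assumes z: "z \<in> mspace Z"
  shows "R z \<in> minimal_values \<longleftrightarrow> z \<in> minimal_values"
proof -
  let ?P = "prod_metric X Y" and ?H = "map_prod T id"
  note bR = dynamical_system_bij_betw[OF system_Z]
  have T: "homeomorphic_map (mtopology_of X) (mtopology_of X) T" "T ` mspace X = mspace X"
    using minimal_X dynamical_system_bij_betw
    by (auto simp: minimal_system_def dynamical_system_def bij_betw_def)
  have H: "homeomorphic_map (mtopology_of ?P) (mtopology_of ?P) ?H"
    using T(1) by (simp add: homeomorphic_map_map_prod)
  have img: "?H ` fibre ?P \<gamma> z = fibre ?P \<gamma> (R z)"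
  proof
    show "?H ` fibre ?P \<gamma> z \<subseteq> fibre ?P \<gamma> (R z)"
    proof
      fix q assume "q \<in> ?H ` fibre ?P \<gamma> z"
      then obtain x y where "q = (T x, y)" "x \<in> mspace X" "y \<in> mspace Y" "\<gamma> (x, y) = z"
        by (force simp: fibre_def)
      then show "q \<in> fibre ?P \<gamma> (R z)" by (simp add: fibre_def \<gamma>_T_id T_closed)
    qed
    show "fibre ?P \<gamma> (R z) \<subseteq> ?H ` fibre ?P \<gamma> z"
    proof
      fix p assume "p \<in> fibre ?P \<gamma> (R z)"
      then obtain x y where p: "p = (x, y)" "x \<in> mspace X" "y \<in> mspace Y" "\<gamma> (x, y) = R z"
        by (auto simp: fibre_def)
      obtain x' where x': "x' \<in> mspace X" "x = T x'" using p(2) T(2) by blast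
      have "\<gamma> (x', y) \<in> mspace Z" using \<gamma>_surj x' p by blast
      \<comment> \<open>Since \<open>T x'\<close> is the first coordinate of \<open>p\<close>, the
        value at \<open>(x', y)\<close> is sent to \<open>R z\<close> by \<open>R\<close>;
        injectivity of \<open>R\<close> identifies it as \<open>z\<close>.\<close>
      moreover have "R (\<gamma> (x', y)) = R z" using p x' by (simp add: \<gamma>_T_id)
      ultimately have "\<gamma> (x', y) = z"
        using z inj_on_eq_iff[OF bij_betw_imp_inj_on[OF bR]] by simp
      then have "(x', y) \<in> fibre ?P \<gamma> z" using x' p by (simp add: fibre_def)
      moreover have "p = ?H (x', y)" using p x' by simp
      ultimately show "p \<in> ?H ` fibre ?P \<gamma> z" by blast
    qed
  qed
  have "minimal_subset ?P (map_prod T S) (?H ` fibre ?P \<gamma> z) \<longleftrightarrow>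
      minimal_subset ?P (map_prod T S) (fibre ?P \<gamma> z)"
    by (rule minimal_subset_image_iff[OF dynamical_system_bij_betw[OF system_prod] H])
      (auto simp: fibre_def)
  then show ?thesis
    using z bij_betw_apply[OF bR z] by (simp add: minimal_values_def img)
qed

text \<open>Because \<open>R\<close> is a homeomorphism, the closure of an invariant set is again
  invariant; being closed and nonempty, it is all of \<open>Z\<close> by minimality.\<close>

lemma dense_minimal_values:
  assumes "minimal_values \<noteq> {}"
  shows "mtopology_of Z closure_of minimal_values = mspace Z"
proof -
  let ?C = "mtopology_of Z closure_of minimal_values"
  note bR = dynamical_system_bij_betw[OF system_Z]
  have sub: "minimal_values \<subseteq> mspace Z" by (auto simp: minimal_values_def)
  have img: "R ` minimal_values = minimal_values"
    by (rule invariant_image_eq[OF bR sub minimal_values_invariant])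
  have "mtopology_of Z closure_of (R ` minimal_values) = R ` ?C"
    by (rule homeomorphic_map_closure_of[OF R_homeomorphic]) (simp add: sub)
  then have RC: "R ` ?C = ?C" unfolding img ..
  have "?C \<subseteq> mspace Z" using closure_of_subset_topspace[of "mtopology_of Z"] by simp
  \<comment> \<open>Injectivity of \<open>R\<close> turns the equality of images into the pointwise
    invariance that \<open>Z_closed_invariant\<close> expects.\<close>
  then have "R z \<in> ?C \<longleftrightarrow> z \<in> ?C" if "z \<in> mspace Z" for z
    using inj_on_image_mem_iff[OF bij_betw_imp_inj_on[OF bR] that, of ?C] RC by simp
  moreover obtain z where "z \<in> ?C"
    using assms closure_of_subset[of minimal_values "mtopology_of Z"] sub by auto
  ultimately show ?thesis
    by (intro Z_closed_invariant[of ?C z]) simp_all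
qed

end

section \<open>Independence of the realization and of the group structure\<close>

text \<open>
  The quantity \<open>\<eta>\<^sub>1 (z + c) - \<eta>\<^sub>2 (w + c)\<close> takes the same value at \<open>c\<close> and at \<open>R c\<close>,
  hence is constant in \<open>c\<close> by minimality, so it depends on \<open>z - w\<close> only.
\<close>

lemma difference_map_factor:
  fixes G (structure) and G' (structure)
  assumes "common_translation_factor X T Y S Z R G \<alpha> \<beta>"
    and "common_translation_factor X T Y S Z' R' G' \<alpha>' \<beta>'"
    and \<eta>: "factor_map Z R Z' R' \<eta>\<^sub>1" "factor_map Z R Z' R' \<eta>\<^sub>2"
    and \<alpha>: "\<And>x. x \<in> mspace X \<Longrightarrow> \<alpha>' x = \<eta>\<^sub>1 (\<alpha> x)" and \<beta>: "\<And>y. y \<in> mspace Y \<Longrightarrow> \<beta>' y = \<eta>\<^sub>2 (\<beta> y)"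
    and p: "p \<in> mspace X \<times> mspace Y" and q: "q \<in> mspace X \<times> mspace Y"
    and eq: "difference_map G \<alpha> \<beta> p = difference_map G \<alpha> \<beta> q"
  shows "difference_map G' \<alpha>' \<beta>' p = difference_map G' \<alpha>' \<beta>' q"
proof -
  interpret A: common_translation_factor X T Y S Z R G \<alpha> \<beta> by fact
  interpret B: common_translation_factor X T Y S Z' R' G' \<alpha>' \<beta>' by fact
  let ?\<zeta> = "mtopology_of Z" and ?\<zeta>' = "mtopology_of Z'"
  obtain g where g: "g \<in> mspace Z" "\<And>z. z \<in> mspace Z \<Longrightarrow> R z = z \<otimes>\<^bsub>G\<^esub> g"
    using A.ex_translation_element by blast
  obtain g' where g': "g' \<in> mspace Z'" "\<And>z. z \<in> mspace Z' \<Longrightarrow> R' z = z \<otimes>\<^bsub>G'\<^esub> g'"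
    using B.ex_translation_element by blast
  have \<eta>_closed [simp]: "\<eta>\<^sub>1 z \<in> mspace Z'" "\<eta>\<^sub>2 z \<in> mspace Z'" if "z \<in> mspace Z" for z
    using \<eta> that by (auto simp: factor_map_def)
  have \<eta>_g: "\<eta>\<^sub>1 (z \<otimes>\<^bsub>G\<^esub> g) = \<eta>\<^sub>1 z \<otimes>\<^bsub>G'\<^esub> g'" "\<eta>\<^sub>2 (z \<otimes>\<^bsub>G\<^esub> g) = \<eta>\<^sub>2 z \<otimes>\<^bsub>G'\<^esub> g'"
    if "z \<in> mspace Z" for z
    using \<eta> that g(2)[OF that] g'(2) \<eta>_closed[OF that] by (auto simp: factor_map_def)
  have const: "\<eta>\<^sub>1 (z \<otimes>\<^bsub>G\<^esub> c) \<otimes>\<^bsub>G'\<^esub> inv\<^bsub>G'\<^esub> (\<eta>\<^sub>2 (w \<otimes>\<^bsub>G\<^esub> c)) = \<eta>\<^sub>1 z \<otimes>\<^bsub>G'\<^esub> inv\<^bsub>G'\<^esub> (\<eta>\<^sub>2 w)"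
    if z: "z \<in> mspace Z" and w: "w \<in> mspace Z" and c: "c \<in> mspace Z" for z w c
  proof -
    let ?D = "\<lambda>c. \<eta>\<^sub>1 (z \<otimes>\<^bsub>G\<^esub> c) \<otimes>\<^bsub>G'\<^esub> inv\<^bsub>G'\<^esub> (\<eta>\<^sub>2 (w \<otimes>\<^bsub>G\<^esub> c))"
    let ?C = "{c \<in> topspace ?\<zeta>. ?D c = ?D \<one>\<^bsub>G\<^esub>}"
    have cont: "continuous_map ?\<zeta> ?\<zeta>' (\<lambda>c. \<eta> (u \<otimes>\<^bsub>G\<^esub> c))"
      if "factor_map Z R Z' R' \<eta>" "u \<in> mspace Z" for \<eta> u
      using that continuous_map_compose[OF A.continuous_map_group_mult, of ?\<zeta> "\<lambda>_. u" "\<lambda>c. c" ?\<zeta>' \<eta>]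
      by (simp add: factor_map_def comp_def)
    have "?D (R c) = ?D c" if c: "c \<in> mspace Z" for c
    proof -
      have "?D (R c) = (\<eta>\<^sub>1 (z \<otimes>\<^bsub>G\<^esub> c) \<otimes>\<^bsub>G'\<^esub> g') \<otimes>\<^bsub>G'\<^esub> inv\<^bsub>G'\<^esub> (\<eta>\<^sub>2 (w \<otimes>\<^bsub>G\<^esub> c) \<otimes>\<^bsub>G'\<^esub> g')"
        using c z w g by (simp add: \<eta>_g flip: A.m_assoc)
      also have "\<dots> = ?D c"
      proof -
        have "g' \<otimes>\<^bsub>G'\<^esub> (inv\<^bsub>G'\<^esub> (\<eta>\<^sub>2 (w \<otimes>\<^bsub>G\<^esub> c)) \<otimes>\<^bsub>G'\<^esub> inv\<^bsub>G'\<^esub> g') = inv\<^bsub>G'\<^esub> (\<eta>\<^sub>2 (w \<otimes>\<^bsub>G\<^esub> c))"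
          using c w g' by (simp add: B.m_lcomm[of g'])
        then show ?thesis using c z w g' by (simp add: B.m_assoc B.inv_mult)
      qed
      finally show ?thesis .
    qed
    moreover have "closedin ?\<zeta> ?C"
      by (rule closedin_continuous_maps_eq[OF B.Hausdorff_Z])
        (use cont \<eta> z w  in \<open>auto intro!: B.continuous_map_group_diff\<close>)
    moreover have "R c \<in> mspace Z" if "c \<in> mspace Z" for c using that g by simp
    ultimately have "?C = mspace Z"
      using A.one_closed by (intro A.Z_closed_invariant[of _ "\<one>\<^bsub>G\<^esub>"]) auto
    then have "?D c = ?D \<one>\<^bsub>G\<^esub>" using c by blast
    then show ?thesis using z w by simp
  qed
  obtain x y u v where pq: "p = (x, y)" "q = (u, v)" and X: "x \<in> mspace X" "u \<in> mspace X"
    and Y: "y \<in> mspace Y" "v \<in> mspace Y" using p q by auto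
  note mem = X[THEN A.\<alpha>_closed] Y[THEN A.\<beta>_closed]
  \<comment> \<open>\<open>c\<close> is the translation taking \<open>\<alpha> x\<close> to
    \<open>\<alpha> u\<close>. Equality of the two differences forces it to take
    \<open>\<beta> y\<close> to \<open>\<beta> v\<close> as well, so \<open>const\<close>
    applies.\<close>
  define c where "c = \<alpha> u \<otimes>\<^bsub>G\<^esub> inv\<^bsub>G\<^esub> (\<alpha> x)"
  have c: "c \<in> mspace Z" using mem by (simp add: c_def)
  have xc: "\<alpha> x \<otimes>\<^bsub>G\<^esub> c = \<alpha> u" using mem by (simp add: c_def A.m_lcomm[of "\<alpha> x"])
  have "\<alpha> x \<otimes>\<^bsub>G\<^esub> inv\<^bsub>G\<^esub> (\<beta> y) = \<alpha> u \<otimes>\<^bsub>G\<^esub> inv\<^bsub>G\<^esub> (\<beta> v)"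
    using eq by (simp add: pq difference_map_def)
  also have "\<dots> = \<alpha> x \<otimes>\<^bsub>G\<^esub> (c \<otimes>\<^bsub>G\<^esub> inv\<^bsub>G\<^esub> (\<beta> v))"
    using mem c by (simp add: xc flip: A.m_assoc)
  finally have "inv\<^bsub>G\<^esub> (\<beta> y) = c \<otimes>\<^bsub>G\<^esub> inv\<^bsub>G\<^esub> (\<beta> v)"
    using mem c by simp
  then have "\<beta> y \<otimes>\<^bsub>G\<^esub> c = \<beta> y \<otimes>\<^bsub>G\<^esub> (inv\<^bsub>G\<^esub> (\<beta> y) \<otimes>\<^bsub>G\<^esub> \<beta> v)"
    using mem c by (simp add: A.m_assoc)
  then have yc: "\<beta> y \<otimes>\<^bsub>G\<^esub> c = \<beta> v" using mem by (simp flip: A.m_assoc)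
  show ?thesis
    using const[OF mem(1) mem(3) c] X Y by (simp add: pq difference_map_def \<alpha> \<beta> xc yc)
qed

lemma max_common_translation_factor:
  assumes "minimal_system X T" "minimal_system Y S"
    and "max_common_equicontinuous_factor X T Y S Z R \<alpha> \<beta>" "group_translation Z R G"
  shows "common_translation_factor X T Y S Z R G \<alpha> \<beta>"
  using assms
  by (simp add: common_translation_factor_def max_common_equicontinuous_factor_def
      equicontinuous_system_def)

text \<open>The universal property, used in both directions, shows that the two difference maps
  identify the same pairs of points. Hence every fibre of one is a fibre of the other, possibly over
  another value.\<close>

lemma ex_minimal_fibre_realization:
  assumes X: "minimal_system X T" and Y: "minimal_system Y S"
    and Z: "max_common_equicontinuous_factor X T Y S Z R \<alpha> \<beta>" "group_translation Z R G"
    and Z': "max_common_equicontinuous_factor X T Y S Z' R' \<alpha>' \<beta>'" "group_translation Z' R' G'"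
    and ex: "\<exists>z\<in>mspace Z. minimal_subset (prod_metric X Y) (map_prod T S)
        (fibre (prod_metric X Y) (difference_map G \<alpha> \<beta>) z)"
  shows "\<exists>z\<in>mspace Z'. minimal_subset (prod_metric X Y) (map_prod T S)
        (fibre (prod_metric X Y) (difference_map G' \<alpha>' \<beta>') z)"
proof -
  let ?P = "prod_metric X Y" and ?\<gamma> = "difference_map G \<alpha> \<beta>" and ?\<gamma>' = "difference_map G' \<alpha>' \<beta>'"
  note A = max_common_translation_factor[OF X Y Z] and B = max_common_translation_factor[OF X Y Z']
  have ZZ: "equicontinuous_system Z R" "factor_map X T Z R \<alpha>" "factor_map Y S Z R \<beta>"
    and ZZ': "equicontinuous_system Z' R'" "factor_map X T Z' R' \<alpha>'" "factor_map Y S Z' R' \<beta>'"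
    using Z(1) Z'(1) by (simp_all add: max_common_equicontinuous_factor_def)
  obtain \<eta>\<^sub>1 \<eta>\<^sub>2 where \<eta>: "factor_map Z R Z' R' \<eta>\<^sub>1" "factor_map Z R Z' R' \<eta>\<^sub>2"
    "\<forall>x\<in>mspace X. \<alpha>' x = \<eta>\<^sub>1 (\<alpha> x)" "\<forall>y\<in>mspace Y. \<beta>' y = \<eta>\<^sub>2 (\<beta> y)"
    using max_common_equicontinuous_factor_universal[OF Z(1) ZZ'] by blast
  obtain \<theta>\<^sub>1 \<theta>\<^sub>2 where \<theta>: "factor_map Z' R' Z R \<theta>\<^sub>1" "factor_map Z' R' Z R \<theta>\<^sub>2"
    "\<forall>x\<in>mspace X. \<alpha> x = \<theta>\<^sub>1 (\<alpha>' x)" "\<forall>y\<in>mspace Y. \<beta> y = \<theta>\<^sub>2 (\<beta>' y)"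
    using max_common_equicontinuous_factor_universal[OF Z'(1) ZZ] by blast
  \<comment> \<open>The maps from \<open>Z\<close> to \<open>Z'\<close> give the implication from
    left to right, those from \<open>Z'\<close> to \<open>Z\<close> its converse.\<close>
  have iff: "?\<gamma> p = ?\<gamma> q \<longleftrightarrow> ?\<gamma>' p = ?\<gamma>' q"
    if "p \<in> mspace X \<times> mspace Y" "q \<in> mspace X \<times> mspace Y" for p q
    using difference_map_factor[OF A B \<eta>(1,2) _ _ that] \<eta>(3,4)
      difference_map_factor[OF B A \<theta>(1,2) _ _ that] \<theta>(3,4) by blast
  obtain z where z: "z \<in> mspace Z" "minimal_subset ?P (map_prod T S) (fibre ?P ?\<gamma> z)"
    using ex by blast
  \<comment> \<open>A minimal subset is nonempty; the value of \<open>?\<gamma>'\<close> at any of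
    its points is the one sought.\<close>
  then obtain p where p: "p \<in> mspace X \<times> mspace Y" "?\<gamma> p = z"
    by (auto simp: minimal_subset_def fibre_def)
  have "fibre ?P ?\<gamma> z = fibre ?P ?\<gamma>' (?\<gamma>' p)"
    using iff p by (force simp: fibre_def)
  moreover have "?\<gamma>' p \<in> mspace Z'"
    using common_translation_factor.\<gamma>_surj[OF B] p by blast
  ultimately show ?thesis using z by auto
qed

section \<open>Realizations on the type of \<open>X\<close>\<close>

text \<open>The isometry \<open>s\<close> conjugates the iterates of \<open>Q\<close> to those of
  \<open>P\<close>, so the same \<delta> works for both systems.\<close>

lemma equicontinuous_system_isometric:
  assumes W: "equicontinuous_system W Q"
    and s: "bij_betw s (mspace W) (mspace V)"
    and iso: "\<And>x y. \<lbrakk>x \<in> mspace W; y \<in> mspace W\<rbrakk> \<Longrightarrow> mdist V (s x) (s y) = mdist W x y"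
    and hom: "homeomorphic_map (mtopology_of W) (mtopology_of V) s"
    and P: "homeomorphic_map (mtopology_of V) (mtopology_of V) P"
      "\<And>w. w \<in> mspace W \<Longrightarrow> P (s w) = s (Q w)"
  shows "equicontinuous_system V P"
  unfolding equicontinuous_system_def dynamical_system_def
proof (intro conjI P(1) allI impI)
  have W': "dynamical_system W Q" using W by (simp add: equicontinuous_system_def)
  then show "compact_space (mtopology_of V)"
    using homeomorphic_compact_space[OF homeomorphic_map_imp_homeomorphic_space[OF hom]]
    by (simp add: dynamical_system_def)
  note it = int_iterate_conj[OF dynamical_system_bij_betw[OF W'] s P(2)]
  fix \<epsilon> :: real assume "\<epsilon> > 0"
  then obtain \<delta> where "\<delta> > 0" and \<delta>: "\<And>x y n. \<lbrakk>x \<in> mspace W; y \<in> mspace W; mdist W x y < \<delta>\<rbrakk> \<Longrightarrow>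
      mdist W (int_iterate (mspace W) Q n x) (int_iterate (mspace W) Q n y) < \<epsilon>"
    using W unfolding equicontinuous_system_def by metis
  have "mspace V = s ` mspace W" using s by (simp add: bij_betw_def)
  then have "\<forall>x\<in>mspace V. \<forall>y\<in>mspace V. mdist V x y < \<delta> \<longrightarrow>
      (\<forall>n. mdist V (int_iterate (mspace V) P n x) (int_iterate (mspace V) P n y) < \<epsilon>)"
    using \<delta> it by (auto simp: iso)
  then show "\<exists>\<delta>>0. \<forall>x\<in>mspace V. \<forall>y\<in>mspace V. mdist V x y < \<delta> \<longrightarrow>
      (\<forall>n. mdist V (int_iterate (mspace V) P n x) (int_iterate (mspace V) P n y) < \<epsilon>)"
    using \<open>\<delta> > 0\<close> by blast
qed

text \<open>\<open>t\<close> pulls arguments back to \<open>Z\<close> and \<open>s\<close> sends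
  results forward, so the group laws and continuity come from \<open>G\<close>; the translating
  element becomes its image under \<open>s\<close>.\<close>

lemma group_translation_transport:
  assumes st: "homeomorphic_maps (mtopology_of Z) (mtopology_of V) s t"
    and Z: "group_translation Z R G"
  shows "group_translation V (s \<circ> R \<circ> t) \<lparr>carrier = mspace V,
    mult = (\<lambda>a b. s (t a \<otimes>\<^bsub>G\<^esub> t b)), one = s \<one>\<^bsub>G\<^esub>\<rparr>"
proof -
  let ?H = "\<lparr>carrier = mspace V, mult = (\<lambda>a b. s (t a \<otimes>\<^bsub>G\<^esub> t b)), one = s \<one>\<^bsub>G\<^esub>\<rparr>"
  interpret G: comm_group G using Z by (simp add: group_translation_def)
  have cG: "carrier G = mspace Z" using Z by (simp add: group_translation_def)
  note Gm [simp] = G.m_closed[unfolded cG] G.inv_closed[unfolded cG] G.one_closed[unfolded cG]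
  have cs: "continuous_map (mtopology_of Z) (mtopology_of V) s"
    and ct: "continuous_map (mtopology_of V) (mtopology_of Z) t"
    and ts [simp]: "\<And>z. z \<in> mspace Z \<Longrightarrow> t (s z) = z"
    and sV [simp]: "\<And>v. v \<in> mspace V \<Longrightarrow> s (t v) = v"
    using st by (auto simp: homeomorphic_maps_def)
  have sc [simp]: "s z \<in> mspace V" if "z \<in> mspace Z" for z
    using continuous_map_image_subset_topspace[OF cs] that by auto
  have tc [simp]: "t v \<in> mspace Z" if "v \<in> mspace V" for v
    using continuous_map_image_subset_topspace[OF ct] that by auto
  have H: "comm_group ?H"
  proof (rule comm_groupI; simp add: cG)
    fix x y z assume V: "x \<in> mspace V" "y \<in> mspace V" "z \<in> mspace V"
    show "s (t x \<otimes>\<^bsub>G\<^esub> t y \<otimes>\<^bsub>G\<^esub> t z) = s (t x \<otimes>\<^bsub>G\<^esub> (t y \<otimes>\<^bsub>G\<^esub> t z))"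
      using V by (simp add: G.m_assoc cG)
  next
    fix x y assume "x \<in> mspace V" "y \<in> mspace V"
    then show "s (t x \<otimes>\<^bsub>G\<^esub> t y) = s (t y \<otimes>\<^bsub>G\<^esub> t x)" by (simp add: G.m_comm cG)
  next
    fix x assume "x \<in> mspace V"
    then show "\<exists>y\<in>mspace V. s (t y \<otimes>\<^bsub>G\<^esub> t x) = s \<one>\<^bsub>G\<^esub>"
      by (intro bexI[of _ "s (inv\<^bsub>G\<^esub> (t x))"]) (simp_all add: cG)
  qed
  then interpret H: comm_group ?H .
  \<comment> \<open>The inverse in \<open>?H\<close> is defined by a description, so it is computed
    before its continuity is shown.\<close>
  have inv: "inv\<^bsub>?H\<^esub> v = s (inv\<^bsub>G\<^esub> (t v))" if "v \<in> mspace V" for v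
    using that by (intro H.inv_equality) (simp_all add: cG)
  have "continuous_map (mtopology_of V) (mtopology_of V) (s \<circ> (\<lambda>a. inv\<^bsub>G\<^esub> a) \<circ> t)"
    using Z cs ct by (auto simp: group_translation_def intro!: continuous_map_compose)
  then have cinv: "continuous_map (mtopology_of V) (mtopology_of V) (\<lambda>a. inv\<^bsub>?H\<^esub> a)"
    by (rule continuous_map_eq) (simp add: inv)
  have "continuous_map (prod_topology (mtopology_of V) (mtopology_of V))
      (prod_topology (mtopology_of Z) (mtopology_of Z)) (\<lambda>(a, b). (t a, t b))"
    using ct by (simp add: continuous_map_prod_top)
  then have "continuous_map (prod_topology (mtopology_of V) (mtopology_of V)) (mtopology_of V)
      (s \<circ> ((\<lambda>(a, b). a \<otimes>\<^bsub>G\<^esub> b) \<circ> (\<lambda>(a, b). (t a, t b))))"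
    using Z cs by (auto simp: group_translation_def intro!: continuous_map_compose)
  then have cm: "continuous_map (prod_topology (mtopology_of V) (mtopology_of V)) (mtopology_of V)
      (\<lambda>(a, b). a \<otimes>\<^bsub>?H\<^esub> b)"
    by (simp add: comp_def case_prod_unfold)
  obtain g where "g \<in> mspace Z" "\<And>z. z \<in> mspace Z \<Longrightarrow> R z = z \<otimes>\<^bsub>G\<^esub> g"
    using Z by (auto simp: group_translation_def)
  then have "\<exists>g\<in>mspace V. \<forall>v\<in>mspace V. (s \<circ> R \<circ> t) v = v \<otimes>\<^bsub>?H\<^esub> g"
    by (intro bexI[of _ "s g"]) auto
  then show ?thesis using H cinv cm by (simp add: group_translation_def)
qed

text \<open>\<open>strongly_quasi_disjoint\<close> quantifies over realizations carried by the type
  of \<open>X\<close>. One is obtained by transporting metric, map and group along a section of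
  \<alpha>.\<close>

lemma ex_realization:
  fixes X :: "'a metric" and Z :: "'c metric"
  assumes max: "max_common_equicontinuous_factor X T Y S Z R \<alpha> \<beta>" and G: "group_translation Z R G"
  shows "\<exists>(V :: 'a metric) P (H :: 'a monoid) \<alpha>' \<beta>'.
    max_common_equicontinuous_factor X T Y S V P \<alpha>' \<beta>' \<and> group_translation V P H"
proof -
  have Z: "equicontinuous_system Z R" and \<alpha>: "factor_map X T Z R \<alpha>" and \<beta>: "factor_map Y S Z R \<beta>"
    using max by (simp_all add: max_common_equicontinuous_factor_def)
  define s where "s = inv_into (mspace X) \<alpha>"
  \<comment> \<open>The metric of \<open>Z\<close> pulled back along \<alpha>, which need not be the
    one induced from \<open>X\<close>. It separates the representatives chosen by \<open>s\<close>
    and makes \<open>s\<close> an isometry of \<open>Z\<close> onto \<open>V\<close>.\<close>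
  define V where "V = metric (s ` mspace Z, \<lambda>a b. mdist Z (\<alpha> a) (\<alpha> b))"
  define P where "P = s \<circ> R \<circ> \<alpha>"
  have \<alpha>s [simp]: "\<alpha> (s z) = z" if "z \<in> mspace Z" for z
    using that \<alpha> unfolding s_def factor_map_def by (metis f_inv_into_f)
  have ms: "Metric_space (s ` mspace Z) (\<lambda>a b. mdist Z (\<alpha> a) (\<alpha> b))"
    by unfold_locales (auto simp: mdist_commute intro: mdist_triangle)
  have V: "mspace V = s ` mspace Z" "mdist V = (\<lambda>a b. mdist Z (\<alpha> a) (\<alpha> b))"
    using Metric_space.mspace_metric[OF ms] Metric_space.mdist_metric[OF ms] by (auto simp: V_def)
  have cs: "continuous_map (mtopology_of Z) (mtopology_of V) s"
    and c\<alpha>: "continuous_map (mtopology_of V) (mtopology_of Z) \<alpha>"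
    by (intro Lipschitz_continuous_imp_continuous_map;
        auto simp: Lipschitz_continuous_map_def V intro!: exI[of _ 1])+
  then have hs: "homeomorphic_maps (mtopology_of Z) (mtopology_of V) s \<alpha>"
    by (auto simp: homeomorphic_maps_def V)
  then have hom: "homeomorphic_map (mtopology_of Z) (mtopology_of V) s"
    "homeomorphic_map (mtopology_of V) (mtopology_of Z) \<alpha>"
    using homeomorphic_maps_sym homeomorphic_map_maps by blast+
  have hR: "homeomorphic_map (mtopology_of Z) (mtopology_of Z) R"
    and bR: "bij_betw R (mspace Z) (mspace Z)"
    using Z dynamical_system_bij_betw by (auto simp: equicontinuous_system_def dynamical_system_def)
  have hP: "homeomorphic_map (mtopology_of V) (mtopology_of V) P"
    unfolding P_def comp_assoc
    by (rule homeomorphic_map_compose[OF homeomorphic_map_compose[OF hom(2) hR] hom(1)])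
  have eV: "equicontinuous_system V P"
    by (rule equicontinuous_system_isometric[OF Z _ _ hom(1) hP])
      (auto simp: V P_def intro!: inj_on_imp_bij_betw inj_on_inverseI[of _ \<alpha>])
  have fs: "factor_map Z R V P s" and ft: "factor_map V P Z R \<alpha>"
    using cs c\<alpha> bij_betw_apply[OF bR] by (auto simp: factor_map_def V P_def image_image)
  have "max_common_equicontinuous_factor X T Y S V P (s \<circ> \<alpha>) (s \<circ> \<beta>)"
    unfolding max_common_equicontinuous_factor_def
  proof (intro conjI allI impI eV factor_map_compose[OF \<alpha> fs] factor_map_compose[OF \<beta> fs])
    fix W :: "'a metric" and Q \<phi> \<psi>
    assume W: "equicontinuous_system W Q \<and> factor_map X T W Q \<phi> \<and> factor_map Y S W Q \<psi>"
    obtain \<eta>\<^sub>1 \<eta>\<^sub>2 where \<eta>: "factor_map Z R W Q \<eta>\<^sub>1" "factor_map Z R W Q \<eta>\<^sub>2"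
      "\<forall>x\<in>mspace X. \<phi> x = \<eta>\<^sub>1 (\<alpha> x)" "\<forall>y\<in>mspace Y. \<psi> y = \<eta>\<^sub>2 (\<beta> y)"
      using max W unfolding max_common_equicontinuous_factor_def by metis
    have "\<alpha> x \<in> mspace Z" if "x \<in> mspace X" for x
      using \<alpha> that by (auto simp: factor_map_def)
    moreover have "\<beta> y \<in> mspace Z" if "y \<in> mspace Y" for y
      using \<beta> that by (auto simp: factor_map_def)
    \<comment> \<open>On \<open>V\<close> the map \<alpha> inverts \<open>s\<close>, so composing
      with it adapts the maps given for \<open>Z\<close>.\<close>
    ultimately show "\<exists>\<eta>\<^sub>1 \<eta>\<^sub>2. factor_map V P W Q \<eta>\<^sub>1 \<and> factor_map V P W Q \<eta>\<^sub>2 \<and>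
        (\<forall>x\<in>mspace X. \<phi> x = \<eta>\<^sub>1 ((s \<circ> \<alpha>) x)) \<and> (\<forall>y\<in>mspace Y. \<psi> y = \<eta>\<^sub>2 ((s \<circ> \<beta>) y))"
      using \<eta> by (intro exI[of _ "\<eta>\<^sub>1 \<circ> \<alpha>"] exI[of _ "\<eta>\<^sub>2 \<circ> \<alpha>"] conjI factor_map_compose[OF ft]) auto
  qed
  moreover have "\<exists>H :: 'a monoid. group_translation V P H"
    using group_translation_transport[OF hs G] by (auto simp: P_def)
  ultimately show ?thesis by blast
qed

section \<open>Residual sets and Baire category\<close>

text \<open>Each open set of the countable family contains the dense set \<Omega> and is therefore
  dense itself.\<close>

lemma gdelta_in_dense_imp_residual_in:
  assumes "gdelta_in X \<Omega>" "X closure_of \<Omega> = topspace X"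
  shows "residual_in X \<Omega>"
proof -
  obtain \<U> where U: "countable \<U>" "\<And>U. U \<in> \<U> \<Longrightarrow> openin X U" "\<Omega> = \<Inter>\<U>"
    using assms(1) unfolding gdelta_in_alt intersection_of_def by blast
  have "X closure_of U = topspace X" if "U \<in> \<U>" for U
  proof
    show "X closure_of U \<subseteq> topspace X" by (rule closure_of_subset_topspace)
    show "topspace X \<subseteq> X closure_of U"
      using closure_of_mono[of \<Omega> U X] that U(3) unfolding assms(2) by blast
  qed
  then have "countable \<U> \<and> (\<forall>U\<in>\<U>. openin X U \<and> X closure_of U = topspace X) \<and>
      topspace X \<inter> \<Inter>\<U> \<subseteq> \<Omega>"
    using U by simp
  then show ?thesis
    unfolding residual_in_def using gdelta_in_subset[OF assms(1)] by (intro conjI[OF _ exI])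
qed

text \<open>By Baire's theorem for compact Hausdorff spaces the countable intersection of dense open
  sets is dense, so it meets a nonempty space.\<close>

lemma residual_in_nonempty:
  assumes "residual_in X \<Omega>" "compact_space X" "Hausdorff_space X" "topspace X \<noteq> {}"
  shows "\<Omega> \<noteq> {}"
proof
  assume "\<Omega> = {}"
  then obtain \<U> where U: "countable \<U>" "\<And>U. U \<in> \<U> \<Longrightarrow> openin X U \<and> X closure_of U = topspace X"
    "topspace X \<inter> \<Inter>\<U> = {}"
    using assms(1) unfolding residual_in_def by blast
  have "X closure_of \<Inter>\<U> = topspace X"
    using assms U
    by (intro Baire_category)
      (auto simp: compact_imp_locally_compact_space compact_Hausdorff_imp_regular_space)
  \<comment> \<open>The closure is compared after restriction to \<open>topspace X\<close>, which
    includes the case of the empty family with intersection \<open>UNIV\<close>.\<close>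
  then show False
    using closure_of_restrict[of X "\<Inter>\<U>"] U(3) assms(4) by simp
qed

theorem theorem3p9:
  fixes X :: "'a metric" and T :: "'a \<Rightarrow> 'a"
    and Y :: "'b metric" and S :: "'b \<Rightarrow> 'b"
    and Z :: "'c metric" and R :: "'c \<Rightarrow> 'c" and G :: "('c, 'm) monoid_scheme"
    and \<alpha> :: "'a \<Rightarrow> 'c" and \<beta> :: "'b \<Rightarrow> 'c" and \<gamma> :: "'a \<times> 'b \<Rightarrow> 'c"
  assumes "minimal_system X T" and "minimal_system Y S"
    and "max_common_equicontinuous_factor X T Y S Z R \<alpha> \<beta>"
    and "group_translation Z R G"
    and "\<gamma> = difference_map G \<alpha> \<beta>"
  shows "((\<exists>z\<in>mspace Z. minimal_subset (prod_metric X Y) (map_prod T S) (fibre (prod_metric X Y) \<gamma> z))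
          \<longleftrightarrow> (\<exists>\<Omega>. gdelta_in (mtopology_of Z) \<Omega> \<and> mtopology_of Z closure_of \<Omega> = mspace Z \<and>
                 (\<forall>z\<in>\<Omega>. minimal_subset (prod_metric X Y) (map_prod T S) (fibre (prod_metric X Y) \<gamma> z))))
       \<and> ((\<exists>\<Omega>. gdelta_in (mtopology_of Z) \<Omega> \<and> mtopology_of Z closure_of \<Omega> = mspace Z \<and>
                 (\<forall>z\<in>\<Omega>. minimal_subset (prod_metric X Y) (map_prod T S) (fibre (prod_metric X Y) \<gamma> z)))
          \<longleftrightarrow> strongly_quasi_disjoint X T Y S)"
    (is "(?one \<longleftrightarrow> ?two) \<and> (_ \<longleftrightarrow> ?three)")
proof -
  note X = assms(1) and Y = assms(2) and Z = assms(3) and G = assms(4) and \<gamma> = assms(5)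
  interpret A: common_translation_factor X T Y S Z R G \<alpha> \<beta>
    by (rule max_common_translation_factor[OF X Y Z G])
  have 12: "?two" if "?one"
  proof -
    have "A.minimal_values \<noteq> {}" using that unfolding A.minimal_values_def \<gamma> by blast
    moreover have "\<forall>z\<in>A.minimal_values.
        minimal_subset (prod_metric X Y) (map_prod T S) (fibre (prod_metric X Y) \<gamma> z)"
      unfolding A.minimal_values_def \<gamma> by blast
    ultimately show ?thesis
      using A.gdelta_in_minimal_values A.dense_minimal_values by blast
  qed
  have 21: "?one" if two: "?two"
  proof -
    obtain \<Omega> where \<Omega>: "gdelta_in (mtopology_of Z) \<Omega>" "mtopology_of Z closure_of \<Omega> = mspace Z"
      "\<forall>z\<in>\<Omega>. minimal_subset (prod_metric X Y) (map_prod T S) (fibre (prod_metric X Y) \<gamma> z)"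
      using two by blast
    \<comment> \<open>The unit of the group witnesses that the space is nonempty, so a dense subset
      of it is nonempty too.\<close>
    have "mspace Z \<noteq> {}" using A.mspace_closed(3) by blast
    then have "\<Omega> \<noteq> {}" using \<Omega>(2) by auto
    moreover have "\<Omega> \<subseteq> mspace Z" using gdelta_in_subset[OF \<Omega>(1)] by simp
    ultimately show ?thesis using \<Omega>(3) by blast
  qed
  have 13: "?three" if "?one"
  proof -
    \<comment> \<open>The minimal fibre is found over \<open>Z\<close>, whose type may differ from
      that of \<open>X\<close>; it is first carried to a realization \<open>V\<close> of the
      required type, where invariance and the G-delta property give a residual set.\<close>
    obtain V :: "'a metric" and P and H :: "'a monoid" and \<alpha>' \<beta>'
      where V: "max_common_equicontinuous_factor X T Y S V P \<alpha>' \<beta>'" "group_translation V P H"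
      using ex_realization[OF Z G] by blast
    interpret B: common_translation_factor X T Y S V P H \<alpha>' \<beta>'
      by (rule max_common_translation_factor[OF X Y V])
    have "B.minimal_values \<noteq> {}"
      using ex_minimal_fibre_realization[OF X Y Z G V] that by (auto simp: B.minimal_values_def \<gamma>)
    then have "residual_in (mtopology_of V) B.minimal_values"
      using B.gdelta_in_minimal_values B.dense_minimal_values
      by (simp add: gdelta_in_dense_imp_residual_in)
    then show ?thesis
      using V unfolding strongly_quasi_disjoint_def B.minimal_values_def by blast
  qed
  have 31: "?one" if three: "?three"
  proof -
    obtain V :: "'a metric" and P and H :: "'a monoid" and \<alpha>' \<beta>' \<Omega>
      where V: "max_common_equicontinuous_factor X T Y S V P \<alpha>' \<beta>'" "group_translation V P H"
        and \<Omega>: "residual_in (mtopology_of V) \<Omega>"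
          "\<forall>z\<in>\<Omega>. minimal_subset (prod_metric X Y) (map_prod T S)
            (fibre (prod_metric X Y) (difference_map H \<alpha>' \<beta>') z)"
      using three unfolding strongly_quasi_disjoint_def by blast
    interpret B: common_translation_factor X T Y S V P H \<alpha>' \<beta>'
      by (rule max_common_translation_factor[OF X Y V])
    have "mspace V \<noteq> {}" using B.mspace_closed(3) by blast
    \<comment> \<open>Baire's theorem supplies a value in \<Omega>; its minimal fibre is then
      carried from \<open>V\<close> back to \<open>Z\<close>.\<close>
    then have "\<Omega> \<noteq> {}"
      using residual_in_nonempty[OF \<Omega>(1)] B.system_Z B.Hausdorff_Z
      by (simp add: dynamical_system_def)
    moreover have "\<Omega> \<subseteq> mspace V" using \<Omega>(1) by (simp add: residual_in_def)
    ultimately show ?thesis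
      using ex_minimal_fibre_realization[OF X Y V Z G] \<Omega>(2) unfolding \<gamma> by blast
  qed
  show ?thesis using 12 21 13 31 by blast
qed

end
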